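(* Let $X$ be a real Banach space with continuous dual $X^*$, and let $A\colon X\rightrightarrows X^*$ be a maximally monotone linear relation such that $\operatorname{gra} A$ is weak$\times$weak$^*$ closed in $X\times X^*$. Then $A$ is non-enlargeable if and only if $$\operatorname{gra}(-A^* )\cap (X\times X^* )\subseteq \operatorname{gra} A.$$ In this situation (i.e., when these equivalent conditions hold), $\langle x,x^*\rangle=0$ for all $(x,x^* )\in\operatorname{gra}(-A^* )\cap (X\times X^* )$.
   Context: $X$ is identified with its canonical image in $X^{**}$, and $\langle\cdot,\cdot\rangle$ denotes duality pairings. A set-valued operator $A\colon X\rightrightarrows X^*$ assigns to each $x\in X$ a subset $Ax\subseteq X^*$; $\operatorname{gra}A:=\{(x,x^* )\in X\times X^*\mid x^*\in Ax\}$. $A$ is monotone if $\langle x-y,x^*-y^*\rangle\ge 0$ for all $(x,x^* ),(y,y^* )\in\operatorname{gra}A$, and maximally monotone if it is monotone and no monotone operator has a graph strictly containing $\operatorname{gra}A$. $A$ is a linear relation if $\operatorname{gra}A$ is a linear subspace. Weak$\times$weak$^*$ closed means closed in the product of the weak topology of $X$ and the weak$^*$ topology of $X^*$. For $\varepsilon\ge0$, the enlargement $A_\varepsilon\colon X\rightrightarrows X^*$ is given by $\operatorname{gra}A_\varepsilon:=\{(x,x^* )\in X\times X^*\mid \langle x^*-y^*,x-y\rangle\ge-\varepsilon,\ \forall (y,y^* )\in\operatorname{gra}A\}$. A monotone operator $A$ is non-enlargeable if $\operatorname{gra}A=\operatorname{gra}A_\varepsilon$ for every $\varepsilon\ge0$.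 The adjoint $A^*\colon X^{**}\rightrightarrows X^*$ is defined by $\operatorname{gra}A^*:=\{(x^{**},x^* )\in X^{**}\times X^*\mid \langle a,x^*\rangle=\langle a^*,x^{**}\rangle,\ \forall (a,a^* )\in\operatorname{gra}A\}$, and $\operatorname{gra}(-A^* )=\{(x^{**},-x^* )\mid (x^{**},x^* )\in\operatorname{gra}A^*\}$. *)

theory Defs
  imports "HOL-Analysis.Analysis"
begin

type_synonym 'a dual = "'a \<Rightarrow>\<^sub>L real"

text \<open>The pairing of \<open>x\<close> with \<open>x'\<close> is \<open>blinfun_apply x' x\<close>, for \<open>X\<close> with its dual and
  equally for the dual with the bidual.\<close>

abbreviation pairing :: "'a::real_normed_vector \<Rightarrow> 'a dual \<Rightarrow> real"
  where "pairing x x' \<equiv> blinfun_apply x' x"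

text \<open>A set-valued operator from \<open>'a\<close> to \<open>'b\<close> is a function \<open>'a \<Rightarrow> 'b set\<close>.\<close>

definition gra :: "('a \<Rightarrow> 'b set) \<Rightarrow> ('a \<times> 'b) set"
  where "gra A = {(x, y). y \<in> A x}"

definition linear_relation :: "('a::real_vector \<Rightarrow> 'b::real_vector set) \<Rightarrow> bool"
  where "linear_relation A \<longleftrightarrow> subspace (gra A)"

definition monotone_op :: "('a::real_normed_vector \<Rightarrow> 'a dual set) \<Rightarrow> bool"
  where "monotone_op A \<longleftrightarrow>
    (\<forall>(x, x') \<in> gra A. \<forall>(y, y') \<in> gra A. pairing (x - y) (x' - y') \<ge> 0)"

definition maximally_monotone :: "('a::real_normed_vector \<Rightarrow> 'a dual set) \<Rightarrow> bool"
  where "maximally_monotone A \<longleftrightarrow>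
    monotone_op A \<and> \<not> (\<exists>B. monotone_op B \<and> gra A \<subset> gra B)"

definition enlargement :: "real \<Rightarrow> ('a::real_normed_vector \<Rightarrow> 'a dual set) \<Rightarrow> 'a \<Rightarrow> 'a dual set"
  where "enlargement \<epsilon> A x =
    {x'. \<forall>(y, y') \<in> gra A. pairing (x - y) (x' - y') \<ge> - \<epsilon>}"

definition non_enlargeable :: "('a::real_normed_vector \<Rightarrow> 'a dual set) \<Rightarrow> bool"
  where "non_enlargeable A \<longleftrightarrow> (\<forall>\<epsilon>\<ge>0. gra A = gra (enlargement \<epsilon> A))"

definition adjoint_op :: "('a::real_normed_vector \<Rightarrow> 'a dual set) \<Rightarrow> 'a dual dual \<Rightarrow> 'a dual set"
  where "adjoint_op A x'' =
    {x'. \<forall>(a, a') \<in> gra A. pairing a x' = pairing a' x''}"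

definition neg_op :: "('a \<Rightarrow> 'b::ab_group_add set) \<Rightarrow> 'a \<Rightarrow> 'b set"
  where "neg_op A x = uminus ` A x"

text \<open>The canonical embedding of \<open>X\<close> into its bidual.\<close>

lift_definition canonical :: "'a::real_normed_vector \<Rightarrow> 'a dual dual"
  is "\<lambda>x x'. pairing x x'"
  by (rule blinfun.bounded_linear_left)

text \<open>For a relation \<open>R\<close> between the bidual and the dual, the set
  \<open>R \<inter> (X \<times> X')\<close>, where \<open>X\<close> is identified with its canonical image and the result is
  regarded as a subset of \<open>X \<times> X'\<close>.\<close>

definition restrict_to_space :: "('a::real_normed_vector dual dual \<times> 'a dual) set \<Rightarrow> ('a \<times> 'a dual) set"
  where "restrict_to_space R = {(x, x'). (canonical x, x') \<in> R}"

text \<open>The coarsest topology on \<open>X\<close> for which all elements of the dual are continuous.\<close>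

definition weak_topology :: "'a::real_normed_vector topology"
  where "weak_topology =
    pullback_topology UNIV (\<lambda>x x'. pairing x x') (product_topology (\<lambda>_. euclideanreal) UNIV)"

text \<open>On the dual, the strong operator topology is the topology of pointwise convergence on \<open>X\<close>.\<close>

definition weak_star_topology :: "'a::real_normed_vector dual topology"
  where "weak_star_topology = strong_operator_topology"

end

theory Submission
  imports Defs
begin

text \<open>Let \<open>G\<close> be the graph of \<open>A\<close>, let \<open>q (x, x') = \<langle>x, x'\<rangle>\<close> with polar form
  \<open>\<beta> ((x, x'), (y, y')) = \<langle>x, y'\<rangle> + \<langle>y, x'\<rangle>\<close>, and let \<open>G\<^sup>\<bottom>\<close> be the \<open>\<beta>\<close>-orthogonal space of \<open>G\<close>,
  which is exactly the part of the graph of \<open>- A\<^sup>*\<close> lying in \<open>X \<times> X\<^sup>*\<close>.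
  If \<open>z \<in> G\<^sup>\<bottom>\<close>, then \<open>q (z - g) = q z + q g \<ge> q z\<close> for \<open>g \<in> G\<close>, so \<open>z\<close> lies in an
  enlargement of \<open>A\<close>; non-enlargeability puts \<open>z\<close> into \<open>G \<inter> G\<^sup>\<bottom>\<close>, where \<open>q\<close> vanishes.
  Conversely, if \<open>z\<close> lies in an enlargement, rescaling \<open>g\<close> shows that \<open>\<beta> (z, g) = 0\<close> whenever
  \<open>g \<in> G\<close> and \<open>q g = 0\<close>. If \<open>G\<^sup>\<bottom> \<subseteq> G\<close>, this applies to all \<open>g \<in> G\<^sup>\<bottom>\<close>, so \<open>z \<in> G\<^sup>\<bottom>\<^sup>\<bottom>\<close>, and
  \<open>G\<^sup>\<bottom>\<^sup>\<bottom> = G\<close> because the topology for which \<open>G\<close> is closed is the one induced by \<open>\<beta>\<close>.\<close>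

text \<open>The values on \<open>F\<close> send \<open>G\<close> to a subspace of a
  finite-dimensional space that misses the image of \<open>z\<close>, so some combination of members
  of \<open>F\<close> separates them. The induction eliminates one member at a time.\<close>

lemma finite_bilinear_separation:
  fixes B :: "'w::real_vector \<Rightarrow> 'v::real_vector \<Rightarrow> real"
  assumes "finite F" and B: "bilinear B" and "subspace G"
    and "\<And>g. g \<in> G \<Longrightarrow> \<exists>w\<in>F. B w g \<noteq> B w z"
  shows "\<exists>w. (\<forall>g\<in>G. B w g = 0) \<and> B w z \<noteq> 0"
  using assms(1,3,4)
proof (induction F arbitrary: G z rule: finite_induct)
  case empty
  then show ?case by (auto dest: subspace_0)
next
  case (insert f F)
  note bil = bilinear_ladd[OF B] bilinear_radd[OF B] bilinear_lmul[OF B] bilinear_rmul[OF B]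
    bilinear_lsub[OF B] bilinear_rsub[OF B]
  show ?case
  proof (cases "\<forall>g\<in>G. B f g = 0")
    case True
    show ?thesis
    proof (cases "B f z = 0")
      case True
      with \<open>\<forall>g\<in>G. B f g = 0\<close> have "\<exists>w\<in>F. B w g \<noteq> B w z" if "g \<in> G" for g
        using insert.prems(2)[OF that] that by auto
      then show ?thesis using insert.IH[OF insert.prems(1)] by blast
    qed (use True in blast)
  next
    case False
    then obtain g1 where g1: "g1 \<in> G" "B f g1 \<noteq> 0" by blast
    \<comment> \<open>With this scaling \<open>G\<close> is the sum of \<open>G0\<close> and the
      line through \<open>g0\<close>, and \<open>z0\<close> is \<open>z\<close> projected along
      \<open>g0\<close> to the kernel of \<open>B f\<close>.\<close>
    define g0 where "g0 = (1 / B f g1) *\<^sub>R g1"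
    have g0: "g0 \<in> G" "B f g0 = 1"
      using g1 insert.prems(1) by (auto simp: g0_def bil subspace_scale)
    define G0 where "G0 = {g \<in> G. B f g = 0}"
    define z0 where "z0 = z - B f z *\<^sub>R g0"
    have G0: "subspace G0"
      using insert.prems(1) bilinear_rzero[OF B] by (auto simp: G0_def subspace_def bil)
    have "\<exists>w\<in>F. B w g \<noteq> B w z0" if "g \<in> G0" for g
    proof -
      have "g + B f z *\<^sub>R g0 \<in> G"
        using that g0(1) insert.prems(1) by (auto simp: G0_def subspace_add subspace_scale)
      from insert.prems(2)[OF this] show ?thesis
        using that g0(2) by (auto simp: G0_def z0_def bil algebra_simps)
    qed
    then obtain h where h: "\<And>g. g \<in> G0 \<Longrightarrow> B h g = 0" "B h z0 \<noteq> 0"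
      using insert.IH[OF G0] by blast
    \<comment> \<open>The multiple of \<open>f\<close> cancels the value of \<open>h\<close> at
      \<open>g0\<close> and changes nothing on \<open>G0\<close>; at \<open>z\<close> the difference
      takes the value \<open>B h z0\<close>.\<close>
    have "B (h - B h g0 *\<^sub>R f) g = 0" if "g \<in> G" for g
    proof -
      have "g - B f g *\<^sub>R g0 \<in> G0"
        using that g0 insert.prems(1) by (auto simp: G0_def bil subspace_diff subspace_scale)
      from h(1)[OF this] show ?thesis by (simp add: bil mult.commute)
    qed
    moreover have "B (h - B h g0 *\<^sub>R f) z \<noteq> 0"
      using h(2) by (simp add: z0_def bil mult.commute)
    ultimately show ?thesis by blast
  qed
qed

text \<open>A basic open set of the product constrains only finitely many coordinates.\<close>

lemma openin_pullback_product_finite: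
  assumes "openin (pullback_topology UNIV f (product_topology (\<lambda>_. euclideanreal) UNIV)) U"
    and "x \<in> U"
  shows "\<exists>F. finite F \<and> (\<forall>y. (\<forall>i\<in>F. f y i = f x i) \<longrightarrow> y \<in> U)"
proof -
  from assms(1) obtain V where
    V: "openin (product_topology (\<lambda>_. euclideanreal) UNIV) V" "U = f -` V"
    by (auto simp: openin_pullback_topology)
  with assms(2) obtain W where
    W: "finite {i. W i \<noteq> UNIV}" "f x \<in> Pi\<^sub>E UNIV W" "Pi\<^sub>E UNIV W \<subseteq> V"
    by (auto simp: openin_product_topology_alt)
  have "y \<in> U" if eq: "\<forall>i\<in>{i. W i \<noteq> UNIV}. f y i = f x i" for y
  proof -
    have "f y i \<in> W i" for i
      using eq W(2) by (cases "W i = UNIV") (auto simp: PiE_iff)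
    then show "y \<in> U" using W(3) V(2) by (auto simp: PiE_iff)
  qed
  with W(1) show ?thesis by blast
qed

definition beta :: "'a::real_normed_vector \<times> 'a dual \<Rightarrow> 'a \<times> 'a dual \<Rightarrow> real"
  where "beta z w = pairing (fst z) (snd w) + pairing (fst w) (snd z)"

lemma bilinear_beta: "bilinear beta"
  unfolding bilinear_def
  by (auto intro!: linearI simp: beta_def blinfun.bilinear_simps algebra_simps)

lemma beta_commute: "beta z w = beta w z"
  by (simp add: beta_def)

lemma closedin_weak_separation:
  fixes G :: "('a::real_normed_vector \<times> 'a dual) set"
  assumes cl: "closedin (prod_topology weak_topology weak_star_topology) G"
    and G: "subspace G" and "z \<notin> G"
  obtains w where "\<And>g. g \<in> G \<Longrightarrow> beta w g = 0" "beta w z \<noteq> 0"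
proof -
  have top: "topspace (prod_topology weak_topology weak_star_topology) = (UNIV :: ('a \<times> 'a dual) set)"
    by (simp add: weak_topology_def weak_star_topology_def strong_operator_topology_topspace
        topspace_pullback_topology)
  obtain x x' where z: "z = (x, x')" by fastforce
  have "openin (prod_topology weak_topology weak_star_topology) (- G)"
    using cl unfolding closedin_def top Compl_eq_Diff_UNIV by (rule conjunct2)
  moreover have "(x, x') \<in> - G" using \<open>z \<notin> G\<close> z by simp
  ultimately obtain U V where UV: "openin weak_topology U" "openin weak_star_topology V"
    "x \<in> U" "x' \<in> V" "U \<times> V \<subseteq> - G"
    unfolding openin_prod_topology_alt by metis
  obtain F where F: "finite F" "\<forall>y. (\<forall>i\<in>F. pairing y i = pairing x i) \<longrightarrow> y \<in> U"
    using openin_pullback_product_finite[OF UV(1)[unfolded weak_topology_def] UV(3)] by blast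
  obtain E where E: "finite E" "\<forall>y. (\<forall>i\<in>E. pairing i y = pairing i x') \<longrightarrow> y \<in> V"
    using openin_pullback_product_finite[OF UV(2)[unfolded weak_star_topology_def
          strong_operator_topology_def euclidean_product_topology[symmetric]] UV(4)] by blast
  \<comment> \<open>\<open>beta (0, i)\<close> applies \<open>i\<close> to the first component and
    \<open>beta (e, 0)\<close> evaluates the second at \<open>e\<close>, so finitely many
    \<open>beta w\<close> control both neighbourhoods.\<close>
  have "\<exists>w\<in>Pair 0 ` F \<union> (\<lambda>e. (e, 0)) ` E. beta w g \<noteq> beta w z" if "g \<in> G" for g
  proof (rule ccontr)
    assume "\<not> ?thesis"
    then have "fst g \<in> U" "snd g \<in> V"
      by (auto intro!: F(2)[rule_format] E(2)[rule_format] simp: beta_def z ball_Un)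
    with UV(5) that show False by (metis ComplD mem_Times_iff subsetD)
  qed
  from finite_bilinear_separation[OF _ bilinear_beta G this] F(1) E(1)
  have "\<exists>w. (\<forall>g\<in>G. beta w g = 0) \<and> beta w z \<noteq> 0" by simp
  with that show thesis by blast
qed

text \<open>The sign in the negated adjoint turns the equality of two pairings into the vanishing of
  their sum.\<close>

lemma restrict_neg_adjoint_iff:
  "z \<in> restrict_to_space (gra (neg_op (adjoint_op A))) \<longleftrightarrow> (\<forall>g\<in>gra A. beta z g = 0)"
proof -
  have "x' \<in> uminus ` S \<longleftrightarrow> - x' \<in> S" for x' :: "'a dual" and S
    by (metis image_iff minus_minus)
  then show ?thesis
    by (cases z) (auto simp: restrict_to_space_def gra_def neg_op_def adjoint_op_def beta_def
        canonical.rep_eq blinfun.minus_left; fastforce)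
qed

text \<open>Since \<open>beta z z\<close> is twice the pairing, this is the defining inequality
  doubled and expanded.\<close>

lemma enlargement_iff:
  "z \<in> gra (enlargement \<epsilon> A) \<longleftrightarrow> (\<forall>g\<in>gra A. beta z z - 2 * beta z g + beta g g \<ge> - 2 * \<epsilon>)"
proof -
  have "pairing (x - y) (x' - y') \<ge> - \<epsilon> \<longleftrightarrow>
    beta (x, x') (x, x') - 2 * beta (x, x') (y, y') + beta (y, y') (y, y') \<ge> - 2 * \<epsilon>"
    for x y :: 'a and x' y' :: "'a dual"
    by (auto simp: beta_def blinfun.bilinear_simps)
  then show ?thesis
    by (cases z) (auto simp: gra_def enlargement_def)
qed

lemma monotone_linear_beta_nonneg:
  assumes "monotone_op A" "linear_relation A" "g \<in> gra A"
  shows "beta g g \<ge> 0"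
proof -
  have "(0, 0) \<in> gra A"
    using subspace_0[OF assms(2)[unfolded linear_relation_def]] by (simp add: zero_prod_def)
  then show ?thesis
    using assms(1,3) unfolding monotone_op_def beta_def by (cases g) fastforce
qed

lemma affine_bounded_below_imp_zero:
  fixes a b :: real
  assumes "\<And>t. a - t * b \<ge> c"
  shows "b = 0"
proof (rule ccontr)
  assume "b \<noteq> 0"
  \<comment> \<open>At this parameter the left-hand side equals \<open>c - 1\<close>.\<close>
  with assms[of "(a - c + 1) / b"] show False by simp
qed

lemma enlargement_orthogonal:
  assumes "linear_relation A" "z \<in> gra (enlargement \<epsilon> A)" "g \<in> gra A" "beta g g = 0"
  shows "beta z g = 0"
proof -
  \<comment> \<open>Testing with \<open>t *\<^sub>R g\<close> leaves an affine function of
    \<open>t\<close>, as the quadratic term carries the factor \<open>beta g g = 0\<close>.\<close>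
  have "beta z z - t * (2 * beta z g) \<ge> - 2 * \<epsilon>" for t
  proof -
    have "t *\<^sub>R g \<in> gra A"
      using assms(1,3) by (auto simp: linear_relation_def subspace_scale)
    with assms(2) have "beta z z - 2 * beta z (t *\<^sub>R g) + beta (t *\<^sub>R g) (t *\<^sub>R g) \<ge> - 2 * \<epsilon>"
      by (simp add: enlargement_iff)
    then show ?thesis
      using assms(4)
      by (simp add: bilinear_lmul[OF bilinear_beta] bilinear_rmul[OF bilinear_beta])
  qed
  then have "2 * beta z g = 0" by (rule affine_bounded_below_imp_zero)
  then show ?thesis by simp
qed

lemma non_enlargeable_imp_orthogonal_subset:
  assumes "monotone_op A" "linear_relation A" "non_enlargeable A"
    and z: "\<And>g. g \<in> gra A \<Longrightarrow> beta z g = 0"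
  shows "z \<in> gra A"
proof -
  \<comment> \<open>This makes \<open>beta z z\<close> at least \<open>- 2 * \<epsilon>\<close>; the
    cross term vanishes and \<open>beta g g\<close> only helps.\<close>
  define \<epsilon> where "\<epsilon> = max 0 (- beta z z / 2)"
  have "z \<in> gra (enlargement \<epsilon> A)"
    unfolding enlargement_iff
  proof
    fix g assume "g \<in> gra A"
    then show "beta z z - 2 * beta z g + beta g g \<ge> - 2 * \<epsilon>"
      using z monotone_linear_beta_nonneg[OF assms(1,2)] by (fastforce simp: \<epsilon>_def)
  qed
  moreover have "\<epsilon> \<ge> 0" by (simp add: \<epsilon>_def)
  ultimately show ?thesis
    using assms(3) by (simp add: non_enlargeable_def)
qed

lemma orthogonal_subset_imp_non_enlargeable:
  assumes "monotone_op A" "linear_relation A"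
    and cl: "closedin (prod_topology weak_topology weak_star_topology) (gra A)"
    and sub: "\<And>w. (\<And>g. g \<in> gra A \<Longrightarrow> beta w g = 0) \<Longrightarrow> w \<in> gra A"
  shows "non_enlargeable A"
  unfolding non_enlargeable_def
proof (intro allI impI set_eqI iffI)
  fix \<epsilon> :: real and z
  assume "\<epsilon> \<ge> 0" and "z \<in> gra A"
  with assms(1) show "z \<in> gra (enlargement \<epsilon> A)"
    by (cases z) (fastforce simp: monotone_op_def gra_def enlargement_def)
next
  fix \<epsilon> :: real and z
  assume z: "z \<in> gra (enlargement \<epsilon> A)"
  show "z \<in> gra A"
  proof (rule ccontr)
    assume "z \<notin> gra A"
    with cl assms(2) obtain w where w: "\<And>g. g \<in> gra A \<Longrightarrow> beta w g = 0" "beta w z \<noteq> 0"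
      using closedin_weak_separation unfolding linear_relation_def by metis
    \<comment> \<open>The separating \<open>w\<close> is orthogonal to the graph and belongs to it,
      hence to itself orthogonal; so \<open>z\<close> must be orthogonal to \<open>w\<close>,
      against the separation.\<close>
    with sub have "w \<in> gra A" "beta w w = 0" by blast+
    from enlargement_orthogonal[OF assms(2) z this] w(2) show False
      by (simp add: beta_commute)
  qed
qed

theorem theorem4p1:
  fixes A :: "'a::banach \<Rightarrow> 'a dual set"
  assumes "maximally_monotone A"
    and "linear_relation A"
    and "closedin (prod_topology weak_topology weak_star_topology) (gra A)"
  shows "(non_enlargeable A \<longleftrightarrow> restrict_to_space (gra (neg_op (adjoint_op A))) \<subseteq> gra A) \<and>
    (non_enlargeable A \<longrightarrow>
      (\<forall>(x, x') \<in> restrict_to_space (gra (neg_op (adjoint_op A))). pairing x x' = 0))"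
proof -
  have mono: "monotone_op A" using assms(1) by (simp add: maximally_monotone_def)
  let ?R = "restrict_to_space (gra (neg_op (adjoint_op A)))"
  have fwd: "?R \<subseteq> gra A" if "non_enlargeable A"
    using non_enlargeable_imp_orthogonal_subset[OF mono assms(2) that]
    by (auto simp: restrict_neg_adjoint_iff)
  moreover have "non_enlargeable A" if "?R \<subseteq> gra A"
    using that restrict_neg_adjoint_iff
    by (intro orthogonal_subset_imp_non_enlargeable[OF mono assms(2,3)]) blast
  moreover have "pairing x x' = 0" if "non_enlargeable A" "(x, x') \<in> ?R" for x x'
  proof -
    have "beta (x, x') (x, x') = 0"
      using fwd that restrict_neg_adjoint_iff by blast
    then show ?thesis by (simp add: beta_def)
  qed
  ultimately show ?thesis by blast
qed

end
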